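(* Let $n\ge2$ be square-free with exactly $k$ distinct prime factors. Then $\Gamma(\mathbb{Z}_n)$ is $k$-partite, i.e. its vertex set can be partitioned into $k$ sets none of which contains two adjacent vertices.
   Context: For a commutative ring $R$ with identity, the zero-divisor graph $\Gamma(R)$ is the simple undirected graph whose vertices are the nonzero zero-divisors of $R$, two distinct vertices $u,v$ being adjacent iff $uv=0$. *)

theory Defs
  imports
    "HOL-Number_Theory.Residues"
    "HOL-Computational_Algebra.Squarefree"
    "HOL-Library.Disjoint_Sets"
    "Graph_Theory.Pair_Digraph"
begin

definition zero_divisors :: "('a, 'b) ring_scheme \<Rightarrow> 'a set" where
  "zero_divisors R =
     {x \<in> carrier R. \<exists>y \<in> carrier R. y \<noteq> \<zero>\<^bsub>R\<^esub> \<and> x \<otimes>\<^bsub>R\<^esub> y = \<zero>\<^bsub>R\<^esub>}"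

text \<open>
  Simple undirected graphs are represented, as in the Graph Theory entry, by symmetric
  irreflexive digraphs without parallel arcs: each edge \<open>{u, v}\<close> is the pair of
  arcs \<open>(u, v)\<close> and \<open>(v, u)\<close>.
\<close>

definition zero_divisor_graph :: "('a, 'b) ring_scheme \<Rightarrow> 'a pair_pre_digraph" where
  "zero_divisor_graph R =
     (let V = zero_divisors R - {\<zero>\<^bsub>R\<^esub>} in
      \<lparr> pverts = V,
        parcs = {(u, v). u \<in> V \<and> v \<in> V \<and> u \<noteq> v \<and> u \<otimes>\<^bsub>R\<^esub> v = \<zero>\<^bsub>R\<^esub>} \<rparr>)"

lemma (in cring) pair_bidirected_zero_divisor_graph:
  "pair_bidirected_digraph (zero_divisor_graph R)"
proof
  show "symmetric (zero_divisor_graph R)"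
    unfolding symmetric_def
  proof (rule symI)
    fix u v
    assume "(u, v) \<in> arcs_ends (with_proj (zero_divisor_graph R))"
    moreover from this have "u \<otimes> v = v \<otimes> u"
      by (intro m_comm) (simp_all add: zero_divisor_graph_def zero_divisors_def Let_def)
    ultimately show "(v, u) \<in> arcs_ends (with_proj (zero_divisor_graph R))"
      by (auto simp add: zero_divisor_graph_def Let_def)
  qed
qed (simp_all add: zero_divisor_graph_def Let_def split: prod.splits)

text \<open>
  The parts are an indexed family and may be empty. This is the usual convention, and it
  is needed already for a graph without vertices such as \<open>\<Gamma>(\<int>\<^sub>p)\<close>, \<open>p\<close> prime, whose only
  partition into one set is the one with an empty part.
\<close>

definition k_partite :: "nat \<Rightarrow> 'a pair_pre_digraph \<Rightarrow> bool" where
  "k_partite k G \<longleftrightarrow>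
     (\<exists>V :: nat \<Rightarrow> 'a set.
        (\<Union>i<k. V i) = pverts G \<and>
        disjoint_family_on V {..<k} \<and>
        (\<forall>i<k. \<forall>u \<in> V i. \<forall>v \<in> V i. (u, v) \<notin> parcs G))"

end

theory Submission
  imports Defs
begin

text \<open>
  List the prime factors of \<open>n\<close> as \<open>p\<^sub>0, \<dots>, p\<^sub>k\<^sub>-\<^sub>1\<close>. As \<open>n\<close> is square-free, a nonzero residue
  \<open>u\<close> is not divisible by some \<open>p\<^sub>i\<close>; colour \<open>u\<close> by such an index. If \<open>u\<close> and \<open>v\<close> both have
  colour \<open>i\<close>, then \<open>p\<^sub>i\<close> does not divide \<open>u v\<close>, hence neither does \<open>n\<close>.
\<close>

text \<open>The parts are the colour classes. Since parts may be empty, \<open>c\<close> need not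
  attain every value below \<open>k\<close>.\<close>

lemma k_partite_if_colouring:
  assumes "\<And>u. u \<in> pverts G \<Longrightarrow> c u < k"
    and "\<And>u v. (u, v) \<in> parcs G \<Longrightarrow> c u \<noteq> c v"
  shows "k_partite k G"
  unfolding k_partite_def
proof (intro exI conjI)
  let ?V = "\<lambda>i. {u \<in> pverts G. c u = i}"
  show "(\<Union>i<k. ?V i) = pverts G"
    using assms(1) by auto
  show "disjoint_family_on ?V {..<k}"
    by (auto simp: disjoint_family_on_def)
  show "\<forall>i<k. \<forall>u \<in> ?V i. \<forall>v \<in> ?V i. (u, v) \<notin> parcs G"
    using assms(2) by fastforce
qed

text \<open>Each prime has multiplicity at most 1 in \<open>n\<close>, so dividing \<open>m\<close>
  once is enough.\<close>

lemma squarefree_dvd_if_prime_factors_dvd: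
  fixes m n :: "'a :: factorial_semiring"
  assumes "squarefree n" and "\<And>p. p \<in> prime_factors n \<Longrightarrow> p dvd m"
  shows "n dvd m"
\<comment> \<open>Zero is split off because \<open>multiplicity p 0\<close> is 0 by convention,
  which would break the comparison.\<close>
proof (cases "m = 0")
  case False
  show ?thesis
  proof (rule multiplicity_le_imp_dvd)
    show "n \<noteq> 0"
      using assms(1) by auto
    show "multiplicity p n \<le> multiplicity p m" if "prime p" for p
    proof (cases "p dvd n")
      case True
      with \<open>n \<noteq> 0\<close> that have "p dvd m"
        by (intro assms(2)) (simp add: prime_factors_dvd)
      with False that have "1 \<le> multiplicity p m"
        by (simp add: prime_multiplicity_gt_zero_iff Suc_le_eq)
      moreover have "multiplicity p n \<le> 1"
        using assms(1) that \<open>n \<noteq> 0\<close> by (simp add: squarefree_factorial_semiring'')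
      ultimately show ?thesis by linarith
    qed (simp add: not_dvd_imp_multiplicity_0)
  qed
qed simp

theorem theorem2p6:
  fixes n k :: nat
  assumes "n \<ge> 2"
    and "squarefree n"
    and "card (prime_factors n) = k"
  shows "k_partite k (zero_divisor_graph (residue_ring (int n)))"
proof -
  obtain p where p: "bij_betw p {0..<k} (prime_factors n)"
    using ex_bij_betw_nat_finite[of "prime_factors n"] assms(3) by auto
  have "\<exists>i<k. \<not> int (p i) dvd u" if "0 < u" "u < int n" for u
  proof (rule ccontr)
    assume "\<not> (\<exists>i<k. \<not> int (p i) dvd u)"
    \<comment> \<open>Residues are integers while the prime factors of \<open>n\<close> are
      naturals; \<open>nat u\<close> moves the divisibility to the naturals.\<close>
    then have "\<forall>q \<in> p ` {0..<k}. int q dvd int (nat u)"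
      using \<open>0 < u\<close> by auto
    then have "q dvd nat u" if "q \<in> prime_factors n" for q
      using that p unfolding bij_betw_def int_dvd_int_iff by blast
    then have "n dvd nat u"
      using assms(2) by (rule squarefree_dvd_if_prime_factors_dvd[rotated])
    with that show False
      by (auto dest: dvd_imp_le)
  qed
  then obtain c where c: "\<And>u. 0 < u \<Longrightarrow> u < int n \<Longrightarrow> c u < k \<and> \<not> int (p (c u)) dvd u"
    by metis
  show ?thesis
  proof (rule k_partite_if_colouring)
    fix u assume "u \<in> pverts (zero_divisor_graph (residue_ring (int n)))"
    then show "c u < k"
      by (intro conjunct1[OF c])
        (auto simp: zero_divisor_graph_def zero_divisors_def residue_ring_def Let_def)
  next
    fix u v assume "(u, v) \<in> parcs (zero_divisor_graph (residue_ring (int n)))"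
    then have u: "0 < u" "u < int n" and v: "0 < v" "v < int n" and "int n dvd u * v"
      by (auto simp: zero_divisor_graph_def zero_divisors_def residue_ring_def Let_def dvd_eq_mod_eq_0)
    have "p (c u) \<in> prime_factors n"
      using c[OF u] p by (auto simp: bij_betw_def)
    then have "prime (int (p (c u)))" "int (p (c u)) dvd int n"
      by (auto simp: in_prime_factors_iff)
    \<comment> \<open>By the choice of \<open>c\<close>, only the second alternative can hold,
      whereas \<open>p (c v)\<close> does not divide \<open>v\<close>; so the colours
      differ.\<close>
    with \<open>int n dvd u * v\<close> have "int (p (c u)) dvd u \<or> int (p (c u)) dvd v"
      by (metis dvd_trans prime_dvd_mult_iff)
    then show "c u \<noteq> c v"
      using c[OF u] c[OF v] by metis
  qed
qed

end
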